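(* Let $F\colon U\to\mathbb{H}$ be a function on a region $U\subset\mathbb{H}$. If $F$ is skew differentiable at some point of an orbit $O\subset U$, then $F$ is skew convex on the orbit $O$. In particular, if $F$ is skew regular on $U$, then it is skew convex on $U$.
   Context: $\mathbb{H}$ is the skew field of quaternions with its Euclidean topology, $\mathbb{H}^*=\mathbb{H}\setminus\{0\}$. $\mathbb{H}^*$ acts on $\mathbb{H}$ by ${}^{p}q=pqp^{-1}$; $O(q)$ is the orbit of $q$. A region is a subset of $\mathbb{H}$ that is open and invariant under this action. $T$ denotes the identity function, and a constant function is denoted by its value. Skew product: for $F,G\colon X\to\mathbb{H}$ on an invariant set $X$, $(F\diamond G)(x)=F({}^{G(x)}x)\,G(x)$ if $G(x)\neq0$, and $(F\diamond G)(x)=0$ if $G(x)=0$. $F\colon X\to\mathbb{H}$ is skew convex (on $X$) if $F\diamond(a+b)=F\diamond a+F\diamond b$ for all constants $a,b\in\mathbb{H}$; $F$ is skew convex on an invariant subset if its restriction to that subset is. $F\colon U\to\mathbb{H}$ on a region $U$ is skew differentiable at $q\in U$ if there is a function $\mathcal{D}_q(F)\colon U\to\mathbb{H}$ continuous at all $p\in O(q)$ with $F=F(q)+\mathcal{D}_q(F)\diamond(T-q)$ as functions on $U$. $F$ is skew regular on $U$ if it is skew differentiable at all points of $U$. *)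

theory Defs
  imports "HOL-Analysis.Analysis"
begin

section \<open>The skew field of quaternions\<close>

text \<open>\<open>Quat a b c d\<close> stands for \<open>a + b i + c j + d k\<close>.\<close>

datatype quat = Quat (qre: real) (qi: real) (qj: real) (qk: real)

lemma quat_eq_iff:
  "p = q \<longleftrightarrow> qre p = qre q \<and> qi p = qi q \<and> qj p = qj q \<and> qk p = qk q"
  by (cases p; cases q) simp

instantiation quat :: real_vector
begin

definition zero_quat :: quat where
  "0 = Quat 0 0 0 0"

definition plus_quat :: "quat \<Rightarrow> quat \<Rightarrow> quat" where
  "p + q = Quat (qre p + qre q) (qi p + qi q) (qj p + qj q) (qk p + qk q)"

definition uminus_quat :: "quat \<Rightarrow> quat" where
  "- p = Quat (- qre p) (- qi p) (- qj p) (- qk p)"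

definition minus_quat :: "quat \<Rightarrow> quat \<Rightarrow> quat" where
  "p - q = Quat (qre p - qre q) (qi p - qi q) (qj p - qj q) (qk p - qk q)"

definition scaleR_quat :: "real \<Rightarrow> quat \<Rightarrow> quat" where
  "r *\<^sub>R p = Quat (r * qre p) (r * qi p) (r * qj p) (r * qk p)"

lemmas quat_additive_defs =
  zero_quat_def plus_quat_def uminus_quat_def minus_quat_def scaleR_quat_def

instance
  by standard (simp_all add: quat_additive_defs algebra_simps)

end

instantiation quat :: division_ring
begin

definition one_quat :: quat where
  "1 = Quat 1 0 0 0"

definition times_quat :: "quat \<Rightarrow> quat \<Rightarrow> quat" where
  "p * q = Quat
     (qre p * qre q - qi p * qi q - qj p * qj q - qk p * qk q)
     (qre p * qi q + qi p * qre q + qj p * qk q - qk p * qj q)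
     (qre p * qj q - qi p * qk q + qj p * qre q + qk p * qi q)
     (qre p * qk q + qi p * qj q - qj p * qi q + qk p * qre q)"

definition inverse_quat :: "quat \<Rightarrow> quat" where
  "inverse p = inverse ((qre p)\<^sup>2 + (qi p)\<^sup>2 + (qj p)\<^sup>2 + (qk p)\<^sup>2) *\<^sub>R
     Quat (qre p) (- qi p) (- qj p) (- qk p)"

definition "p div q = p * inverse q" for p q :: quat

lemma quat_nonzero_sum_squares:
  assumes "p \<noteq> (0::quat)"
  shows "(qre p)\<^sup>2 + (qi p)\<^sup>2 + (qj p)\<^sup>2 + (qk p)\<^sup>2 \<noteq> 0"
proof
  assume 0: "(qre p)\<^sup>2 + (qi p)\<^sup>2 + (qj p)\<^sup>2 + (qk p)\<^sup>2 = 0"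
  have "0 \<le> (qre p)\<^sup>2" "0 \<le> (qi p)\<^sup>2" "0 \<le> (qj p)\<^sup>2" "0 \<le> (qk p)\<^sup>2"
    by auto
  with 0 have "(qre p)\<^sup>2 = 0" "(qi p)\<^sup>2 = 0" "(qj p)\<^sup>2 = 0" "(qk p)\<^sup>2 = 0"
    by linarith+
  with assms show False
    by (simp add: quat_eq_iff zero_quat_def)
qed

instance
proof
  fix p q r :: quat
  show "p * q * r = p * (q * r)"
    by (simp add: times_quat_def algebra_simps)
  show "(p + q) * r = p * r + q * r" "p * (q + r) = p * q + p * r"
    by (simp_all add: times_quat_def plus_quat_def algebra_simps)
  show "1 * p = p" "p * 1 = p"
    by (simp_all add: times_quat_def one_quat_def)
  show "(0::quat) \<noteq> 1"
    by (simp add: zero_quat_def one_quat_def)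
  show "p div q = p * inverse q"
    by (rule divide_quat_def)
  show "inverse (0::quat) = 0"
    by (simp add: inverse_quat_def quat_additive_defs)
  assume "p \<noteq> 0"
  define m where "m = inverse ((qre p)\<^sup>2 + (qi p)\<^sup>2 + (qj p)\<^sup>2 + (qk p)\<^sup>2)"
  have m: "m * ((qre p)\<^sup>2 + (qi p)\<^sup>2 + (qj p)\<^sup>2 + (qk p)\<^sup>2) = 1"
    unfolding m_def using quat_nonzero_sum_squares[OF \<open>p \<noteq> 0\<close>] by (rule left_inverse)
  have inv: "inverse p = m *\<^sub>R Quat (qre p) (- qi p) (- qj p) (- qk p)"
    by (simp add: inverse_quat_def m_def)
  have "inverse p * p = Quat (m * ((qre p)\<^sup>2 + (qi p)\<^sup>2 + (qj p)\<^sup>2 + (qk p)\<^sup>2)) 0 0 0"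
    "p * inverse p = Quat (m * ((qre p)\<^sup>2 + (qi p)\<^sup>2 + (qj p)\<^sup>2 + (qk p)\<^sup>2)) 0 0 0"
    unfolding inv by (simp_all add: times_quat_def scaleR_quat_def power2_eq_square algebra_simps)
  then show "inverse p * p = 1" "p * inverse p = 1"
    by (simp_all add: m one_quat_def)
qed

end

instantiation quat :: real_inner
begin

definition inner_quat :: "quat \<Rightarrow> quat \<Rightarrow> real" where
  "p \<bullet> q = qre p * qre q + qi p * qi q + qj p * qj q + qk p * qk q"

definition norm_quat :: "quat \<Rightarrow> real" where
  "norm p = sqrt ((qre p)\<^sup>2 + (qi p)\<^sup>2 + (qj p)\<^sup>2 + (qk p)\<^sup>2)"

definition "sgn p = p /\<^sub>R norm p" for p :: quat

definition "dist p q = norm (p - q)" for p q :: quat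

definition
  "(uniformity :: (quat \<times> quat) filter) = (INF e\<in>{0<..}. principal {(x, y). dist x y < e})"

definition
  "open U \<longleftrightarrow> (\<forall>x\<in>U. \<forall>\<^sub>F (x', y) in uniformity. x' = x \<longrightarrow> y \<in> U)" for U :: "quat set"

instance
proof
  fix p q r :: quat and a :: real and U :: "quat set"
  show "dist p q = norm (p - q)" by (rule dist_quat_def)
  show "sgn p = p /\<^sub>R norm p" by (rule sgn_quat_def)
  show "(uniformity :: (quat \<times> quat) filter) = (INF e\<in>{0<..}. principal {(x, y). dist x y < e})"
    by (rule uniformity_quat_def)
  show "open U \<longleftrightarrow> (\<forall>x\<in>U. \<forall>\<^sub>F (x', y) in uniformity. x' = x \<longrightarrow> y \<in> U)"
    by (rule open_quat_def)
  show "p \<bullet> q = q \<bullet> p" "(p + q) \<bullet> r = p \<bullet> r + q \<bullet> r" "(a *\<^sub>R p) \<bullet> q = a * (p \<bullet> q)"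
    by (simp_all add: inner_quat_def plus_quat_def scaleR_quat_def algebra_simps)
  show "0 \<le> p \<bullet> p"
    by (simp add: inner_quat_def)
  show "p \<bullet> p = 0 \<longleftrightarrow> p = 0"
    using quat_nonzero_sum_squares[of p]
    by (auto simp: inner_quat_def zero_quat_def power2_eq_square)
  show "norm p = sqrt (p \<bullet> p)"
    by (simp add: norm_quat_def inner_quat_def power2_eq_square)
qed

end

instance quat :: real_normed_div_algebra
proof
  fix p q :: quat and a :: real
  show "(a *\<^sub>R p) * q = a *\<^sub>R (p * q)" "p * (a *\<^sub>R q) = a *\<^sub>R (p * q)"
    by (simp_all add: times_quat_def scaleR_quat_def algebra_simps)
  have "(qre (p * q))\<^sup>2 + (qi (p * q))\<^sup>2 + (qj (p * q))\<^sup>2 + (qk (p * q))\<^sup>2 =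
    ((qre p)\<^sup>2 + (qi p)\<^sup>2 + (qj p)\<^sup>2 + (qk p)\<^sup>2) * ((qre q)\<^sup>2 + (qi q)\<^sup>2 + (qj q)\<^sup>2 + (qk q)\<^sup>2)"
    by (simp add: times_quat_def power2_eq_square algebra_simps)
  then show "norm (p * q) = norm p * norm q"
    by (simp add: norm_quat_def real_sqrt_mult)
qed

instantiation quat :: euclidean_space
begin

definition Basis_quat :: "quat set" where
  "Basis = {Quat 1 0 0 0, Quat 0 1 0 0, Quat 0 0 1 0, Quat 0 0 0 1}"

instance
proof
  show "(Basis :: quat set) \<noteq> {}" "finite (Basis :: quat set)"
    by (simp_all add: Basis_quat_def)
  show "u \<bullet> v = (if u = v then 1 else 0)" if "u \<in> Basis" "v \<in> Basis" for u v :: quat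
    using that unfolding Basis_quat_def
    by (elim insertE emptyE; simp only:; simp add: inner_quat_def)
  show "(\<forall>u\<in>Basis. x \<bullet> u = 0) \<longleftrightarrow> x = 0" for x :: quat
    by (cases x) (simp add: Basis_quat_def inner_quat_def zero_quat_def)
qed

end


section \<open>Orbits and regions\<close>

definition qconj :: "quat \<Rightarrow> quat \<Rightarrow> quat" where
  "qconj p q = p * q * inverse p"

definition qorbit :: "quat \<Rightarrow> quat set" where
  "qorbit q = {qconj p q | p. p \<noteq> 0}"

definition qinvariant :: "quat set \<Rightarrow> bool" where
  "qinvariant X \<longleftrightarrow> (\<forall>p x. p \<noteq> 0 \<longrightarrow> x \<in> X \<longrightarrow> qconj p x \<in> X)"

definition region :: "quat set \<Rightarrow> bool" where
  "region U \<longleftrightarrow> open U \<and> qinvariant U"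


section \<open>Skew product, skew convexity, skew differentiability\<close>

text \<open>
  A function on an invariant set \<open>X\<close> is represented by a total function whose values off \<open>X\<close> are
  irrelevant: for \<open>x \<in> X\<close> the value of the skew product at \<open>x\<close> depends only on \<open>G x\<close> and on the
  values of \<open>F\<close> on the orbit of \<open>x\<close>, which is contained in \<open>X\<close>. Restriction to an invariant subset
  is therefore expressed by the set argument of the notions below.
\<close>

definition skew_prod :: "(quat \<Rightarrow> quat) \<Rightarrow> (quat \<Rightarrow> quat) \<Rightarrow> quat \<Rightarrow> quat"  (infixl "\<diamondop>" 70) where
  "(F \<diamondop> G) x = (if G x = 0 then 0 else F (qconj (G x) x) * G x)"

definition skew_convex_on :: "quat set \<Rightarrow> (quat \<Rightarrow> quat) \<Rightarrow> bool" where
  "skew_convex_on X F \<longleftrightarrow>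
     (\<forall>a b. \<forall>x\<in>X. (F \<diamondop> (\<lambda>_. a + b)) x = (F \<diamondop> (\<lambda>_. a)) x + (F \<diamondop> (\<lambda>_. b)) x)"

definition skew_differentiable_at :: "quat set \<Rightarrow> (quat \<Rightarrow> quat) \<Rightarrow> quat \<Rightarrow> bool" where
  "skew_differentiable_at U F q \<longleftrightarrow>
     (\<exists>D. (\<forall>p\<in>qorbit q. continuous (at p within U) D) \<and>
          (\<forall>x\<in>U. F x = F q + (D \<diamondop> (\<lambda>y. y - q)) x))"

definition skew_regular_on :: "quat set \<Rightarrow> (quat \<Rightarrow> quat) \<Rightarrow> bool" where
  "skew_regular_on U F \<longleftrightarrow> (\<forall>q\<in>U. skew_differentiable_at U F q)"

end

theory Submission
  imports Defs
begin

text \<open>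
  Two distinct points \<open>x\<close>, \<open>q\<close> of one orbit have the same minimal quadratic polynomial over the
  reals, whence \<open>(x - q) x = q' (x - q)\<close> with \<open>q'\<close> the conjugate of \<open>q\<close>. The difference quotient
  at \<open>q\<close> is thus evaluated at the single point \<open>q'\<close> as \<open>x\<close> runs through the orbit, so that \<open>F\<close> is
  there of the form \<open>x \<mapsto> c + a x\<close>, and functions of this form are skew convex.
\<close>

definition quat_cnj :: "quat \<Rightarrow> quat" where
  "quat_cnj q = Quat (qre q) (- qi q) (- qj q) (- qk q)"

lemma qre_mult_commute: "qre (p * q) = qre (q * p)"
  by (simp add: times_quat_def)

lemma qre_qconj: "p \<noteq> 0 \<Longrightarrow> qre (qconj p q) = qre q"
  unfolding qconj_def by (subst qre_mult_commute) (simp add: mult.assoc[symmetric])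

lemma norm_qconj: "p \<noteq> 0 \<Longrightarrow> norm (qconj p q) = norm q"
  by (simp add: qconj_def norm_mult norm_inverse)

lemma qconj_qconj: "qconj a (qconj b q) = qconj (a * b) q"
  by (cases "a = 0 \<or> b = 0")
     (auto simp: qconj_def nonzero_inverse_mult_distrib mult.assoc)

lemma self_in_qorbit: "q \<in> qorbit q"
  unfolding qorbit_def qconj_def by (auto intro: exI[of _ 1])

lemma qinvariant_qorbit: "qinvariant (qorbit q)"
  unfolding qinvariant_def qorbit_def by (auto simp: qconj_qconj intro: no_zero_divisors)

lemma qorbit_subset: "qinvariant X \<Longrightarrow> q \<in> X \<Longrightarrow> qorbit q \<subseteq> X"
  by (auto simp: qinvariant_def qorbit_def)

text \<open>With t twice the common real part and n the common squared norm, x^2 = t x - n,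
  \<open>quat_cnj q\<close> = t - q and \<open>quat_cnj q * q\<close> = n, so both sides equal t x -
  n - q x.\<close>

lemma diff_mult_eq_cnj_mult_diff:
  assumes "qre x = qre q" "norm x = norm q"
  shows "(x - q) * x = quat_cnj q * (x - q)"
proof -
  have "(qi x)\<^sup>2 + (qj x)\<^sup>2 + (qk x)\<^sup>2 = (qi q)\<^sup>2 + (qj q)\<^sup>2 + (qk q)\<^sup>2"
    using assms by (simp add: norm_quat_def)
  with assms(1) show ?thesis
    by (simp add: times_quat_def minus_quat_def quat_cnj_def power2_eq_square algebra_simps)
qed

lemma qconj_diff_eq_cnj:
  assumes "x \<in> qorbit p" "q \<in> qorbit p" "x \<noteq> q"
  shows "qconj (x - q) x = quat_cnj q"
proof -
  have "qre x = qre q" "norm x = norm q"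
    using assms(1,2) by (auto simp: qorbit_def qre_qconj norm_qconj)
  then have "qconj (x - q) x = quat_cnj q * (x - q) * inverse (x - q)"
    by (simp add: qconj_def diff_mult_eq_cnj_mult_diff)
  with assms(3) show ?thesis
    by (simp add: mult.assoc)
qed

lemma skew_convex_on_affine:
  assumes "qinvariant X" "\<And>x. x \<in> X \<Longrightarrow> F x = c + a * x"
  shows "skew_convex_on X F"
proof -
  \<comment> \<open>The trailing \<open>inverse b\<close> of \<open>qconj b x\<close> cancels
    against the factor \<open>b\<close> of the skew product. What remains is additive in
    \<open>b\<close> and also gives the value 0 at \<open>b = 0\<close>.\<close>
  have "(F \<diamondop> (\<lambda>_. b)) x = c * b + a * b * x" if "x \<in> X" for b x
  proof (cases "b = 0")
    case False
    with assms that have "F (qconj b x) = c + a * qconj b x"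
      by (simp add: qinvariant_def)
    with False show ?thesis
      by (simp add: skew_prod_def qconj_def distrib_right mult.assoc)
  qed (simp add: skew_prod_def)
  then show ?thesis
    by (simp add: skew_convex_on_def algebra_simps)
qed

lemma skew_convex_on_qorbit:
  assumes "qorbit p \<subseteq> U" "q \<in> qorbit p" "skew_differentiable_at U F q"
  shows "skew_convex_on (qorbit p) F"
proof -
  obtain D where D: "F x = F q + (D \<diamondop> (\<lambda>y. y - q)) x" if "x \<in> U" for x
    using assms(3) by (auto simp: skew_differentiable_at_def)
  \<comment> \<open>For every \<open>x\<close> of the orbit other than \<open>q\<close>, the skew
    product evaluates \<open>D\<close> at this one point, so \<open>F x = F q + a * (x - q)\<close>;
    at \<open>x = q\<close> this is trivial.\<close>
  define a where "a = D (quat_cnj q)"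
  have "F x = (F q - a * q) + a * x" if x: "x \<in> qorbit p" for x
  proof (cases "x = q")
    case False
    have "F x = F q + (D \<diamondop> (\<lambda>y. y - q)) x"
      using D assms(1) x by blast
    with False show ?thesis
      by (simp add: skew_prod_def qconj_diff_eq_cnj[OF x assms(2)] a_def algebra_simps)
  qed simp
  with qinvariant_qorbit show ?thesis
    by (rule skew_convex_on_affine)
qed

theorem proposition3p12:
  fixes U :: "quat set" and F :: "quat \<Rightarrow> quat"
  assumes "region U"
  shows "(\<forall>O\<^sub>0 \<in> range qorbit. O\<^sub>0 \<subseteq> U \<longrightarrow>
            (\<exists>q\<in>O\<^sub>0. skew_differentiable_at U F q) \<longrightarrow> skew_convex_on O\<^sub>0 F) \<and>
         (skew_regular_on U F \<longrightarrow> skew_convex_on U F)"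
proof (intro conjI impI ballI)
  fix O\<^sub>0
  assume "O\<^sub>0 \<in> range qorbit" "O\<^sub>0 \<subseteq> U" "\<exists>q\<in>O\<^sub>0. skew_differentiable_at U F q"
  then show "skew_convex_on O\<^sub>0 F"
    using skew_convex_on_qorbit by blast
next
  assume reg: "skew_regular_on U F"
  \<comment> \<open>Skew convexity is a pointwise condition and each point lies in its own orbit, so
    orbits can be treated one at a time.\<close>
  have "skew_convex_on (qorbit x) F" if "x \<in> U" for x
    using assms reg that skew_convex_on_qorbit[OF qorbit_subset self_in_qorbit]
    by (auto simp: region_def skew_regular_on_def)
  then show "skew_convex_on U F"
    using self_in_qorbit unfolding skew_convex_on_def by blast
qed

end
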